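(* Let $(T,\ell)$ be a pair consisting of a rooted tree $T$ (not necessarily locally finite) and a length function $\ell$ on $T$. Let $T_0$ be the locally finite component of $T$, with the induced length function $\ell_0$ and capacity function $\chi_0$. Then for all $n$, $$n!_{(T,\ell)}=n!_{(T_0,\ell_0,\chi_0)}.$$
   Context: A rooted tree $T$ has root $\mathfrak r$ and edges oriented away from the root; a length function is $\ell:E(T)\to\mathbb R_{+}$ with (strictly) positive values. A leaf is a vertex $v\neq\mathfrak r$ of valence one, or $\mathfrak r$ itself if $T=\{\mathfrak r\}$; $L(T)$ is the set of leaves. $\partial T$ is the set of infinite oriented paths from $\mathfrak r$ and $\widetilde\partial T$ is the union of $\partial T$ and the set of oriented paths from $\mathfrak r$ to a leaf. For $\rho,\tau\in\widetilde\partial T$ (distinct if both in $\partial T$), $\langle\rho,\tau\rangle$ is the sum of $\ell(e)$ over the common edges $e$ of $\rho$ and $\tau$. Factorials without capacity: choose $\rho_0\in\widetilde\partial T$ arbitrarily; given $\rho_0,\dots,\rho_{n-1}$ choose, if possible, $\rho_n\in\widetilde\partial T\setminus\{\rho_0,\dots,\rho_{n-1}\}$ minimizing $\sum_{j<n}\langle\rho,\rho_j\rangle$; $n!_{(T,\ell)}:=\sum_{j<n}\langle\rho_n,\rho_j\rangle$. Factorials with a capacity function $\chi:L(T)\to\{1,2,\dots\}\cup\{\infty\}$ (for locally finite $T$): the same procedure, except that $\rho_n$ is chosen minimizing $\sum_{j<n}\langle\rho,\rho_j\rangle$ among those $\rho\in\widetilde\partial T$ such that either $\rho\in\partial T$ was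 not chosen before, or $\rho$ ends at a leaf $v$ and was chosen strictly fewer than $\chi(v)$ times before; $n!_{(T,\ell,\chi)}:=\sum_{j<n}\langle\rho_n,\rho_j\rangle$. In both cases the resulting numbers are independent of the choices. Locally finite component: let $V_0$ be the set of vertices $v$ of $T$ such that every vertex other than $v$ on the oriented path from $\mathfrak r$ to $v$ has finite valence in $T$ (so $V_0=\{\mathfrak r\}$ if $\mathfrak r$ has infinite valence). $T_0$ is the subtree of $T$ induced on $V_0$, rooted at $\mathfrak r$; $\ell_0$ is the restriction of $\ell$ to $E(T_0)$; for a leaf $v$ of $T_0$, $\chi_0(v)=\infty$ if $v$ has infinite valence in $T$, and $\chi_0(v)=1$ otherwise (in which case $v$ is a leaf of $T$). The equality for all $n$ means that the two sequences have the same length and the same terms. *)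

theory Defs
  imports
    Complex_Main
    "HOL-Library.FuncSet"
    "HOL-Library.Extended_Nat"
    "Graph_Theory.Digraph_Component"
begin

section \<open>Rooted trees\<close>

text \<open>
  A rooted tree is represented by the digraph in which every edge is oriented away from the
  root: the root is a vertex and every vertex is reached from it by exactly one directed walk.
  This rules out arcs into the root, loops, parallel and antiparallel arcs, vertices with two
  parents and directed cycles, so that the underlying undirected graph is a tree.  No finiteness
  is assumed.  (The constant \<^const>\<open>tree\<close> of the graph library is not usable here: it only
  excludes directed cycles.)
\<close>

locale rooted_tree = wf_digraph T for T :: "('v, 'e) pre_digraph" +
  fixes r :: 'v
  assumes root_in_verts: "r \<in> verts T"
    and unique_awalk: "v \<in> verts T \<Longrightarrow> \<exists>!p. awalk r p v"

definition length_function :: "('v, 'e) pre_digraph \<Rightarrow> ('e \<Rightarrow> real) \<Rightarrow> bool" where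
  "length_function T l \<longleftrightarrow> (\<forall>e\<in>arcs T. 0 < l e)"

definition incident_arcs :: "('v, 'e) pre_digraph \<Rightarrow> 'v \<Rightarrow> 'e set" where
  "incident_arcs T v = in_arcs T v \<union> out_arcs T v"

definition finite_valence :: "('v, 'e) pre_digraph \<Rightarrow> 'v \<Rightarrow> bool" where
  "finite_valence T v \<longleftrightarrow> finite (incident_arcs T v)"

definition locally_finite :: "('v, 'e) pre_digraph \<Rightarrow> bool" where
  "locally_finite T \<longleftrightarrow> (\<forall>v\<in>verts T. finite_valence T v)"

text \<open>
  Since \<^const>\<open>card\<close> is \<open>0\<close> on infinite sets, \<open>card \<dots> = 1\<close> includes finiteness of the valence.
\<close>

definition leaves :: "('v, 'e) pre_digraph \<Rightarrow> 'v \<Rightarrow> 'v set" where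
  "leaves T r = {v \<in> verts T. v \<noteq> r \<and> card (incident_arcs T v) = 1}
                \<union> (if verts T = {r} then {r} else {})"

section \<open>Infinite paths and paths to leaves\<close>

text \<open>
  Oriented paths starting at the root are given by their sequence of arcs; the empty list is the
  trivial path at the root.
\<close>

datatype 'e opath = Leaf_Path "'e list" | Ray "nat \<Rightarrow> 'e"

fun path_arcs :: "'e opath \<Rightarrow> 'e set" where
  "path_arcs (Leaf_Path p) = set p"
| "path_arcs (Ray f) = range f"

definition boundary :: "('v, 'e) pre_digraph \<Rightarrow> 'v \<Rightarrow> 'e opath set" where
  "boundary T r = {Ray f | f. tail T (f 0) = r \<and>
                     (\<forall>i. f i \<in> arcs T \<and> head T (f i) = tail T (f (Suc i)))}"

definition leaf_paths_to :: "('v, 'e) pre_digraph \<Rightarrow> 'v \<Rightarrow> 'v \<Rightarrow> 'e opath set" where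
  "leaf_paths_to T r v = {Leaf_Path p | p. v \<in> leaves T r \<and> pre_digraph.awalk T r p v}"

definition ext_boundary :: "('v, 'e) pre_digraph \<Rightarrow> 'v \<Rightarrow> 'e opath set" where
  "ext_boundary T r = boundary T r \<union> (\<Union>v. leaf_paths_to T r v)"

text \<open>
  For two equal rays the intersection is infinite and the sum below has the junk value \<open>0\<close>.
  This case never occurs in the procedures below, which never choose a ray twice.
\<close>

definition pairing :: "('e \<Rightarrow> real) \<Rightarrow> 'e opath \<Rightarrow> 'e opath \<Rightarrow> real" where
  "pairing l \<rho> \<tau> = (\<Sum>e\<in>path_arcs \<rho> \<inter> path_arcs \<tau>. l e)"

section \<open>Factorials\<close>

text \<open>
  \<open>adm \<rho>s\<close> is the set of paths that may be chosen after the paths in the list \<open>\<rho>s\<close>.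
  The predicate \<open>greedy adm l \<rho>s\<close> says that \<open>\<rho>s = [\<rho>\<^sub>0, \<dots>, \<rho>\<^sub>n\<^sub>-\<^sub>1]\<close> is a possible outcome of the first \<open>n\<close>
  steps of the procedure; for \<open>n = 0\<close> the minimised sum is empty, so \<open>\<rho>\<^sub>0\<close> is an arbitrary element
  of \<open>adm []\<close>.
\<close>

definition pairing_sum :: "('e \<Rightarrow> real) \<Rightarrow> 'e opath list \<Rightarrow> 'e opath \<Rightarrow> real" where
  "pairing_sum l \<rho>s \<rho> = (\<Sum>j<length \<rho>s. pairing l \<rho> (\<rho>s ! j))"

inductive greedy :: "('e opath list \<Rightarrow> 'e opath set) \<Rightarrow> ('e \<Rightarrow> real) \<Rightarrow> 'e opath list \<Rightarrow> bool"
  for adm l where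
  "greedy adm l []"
| "greedy adm l \<rho>s \<Longrightarrow> is_arg_min (pairing_sum l \<rho>s) (\<lambda>\<rho>. \<rho> \<in> adm \<rho>s) \<rho>
    \<Longrightarrow> greedy adm l (\<rho>s @ [\<rho>])"

definition factorial_value ::
    "('e opath list \<Rightarrow> 'e opath set) \<Rightarrow> ('e \<Rightarrow> real) \<Rightarrow> nat \<Rightarrow> real \<Rightarrow> bool" where
  "factorial_value adm l n x \<longleftrightarrow>
     (\<exists>\<rho>s \<rho>. length \<rho>s = n \<and> greedy adm l (\<rho>s @ [\<rho>]) \<and> x = pairing_sum l \<rho>s \<rho>)"

text \<open>
  The sequence of factorials may be finite; it is a partial function, undefined at \<open>n\<close> if no
  \<open>\<rho>\<^sub>n\<close> can be chosen.  The definite description reflects that the value does not depend on the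
  choices made.
\<close>

definition factorial_seq :: "('e opath list \<Rightarrow> 'e opath set) \<Rightarrow> ('e \<Rightarrow> real) \<Rightarrow> nat \<rightharpoonup> real" where
  "factorial_seq adm l n =
     (if \<exists>x. factorial_value adm l n x then Some (THE x. factorial_value adm l n x) else None)"

definition tree_factorial ::
    "('v, 'e) pre_digraph \<Rightarrow> 'v \<Rightarrow> ('e \<Rightarrow> real) \<Rightarrow> nat \<rightharpoonup> real" where
  "tree_factorial T r l = factorial_seq (\<lambda>\<rho>s. ext_boundary T r - set \<rho>s) l"

definition cap_admissible ::
    "('v, 'e) pre_digraph \<Rightarrow> 'v \<Rightarrow> ('v \<Rightarrow> enat) \<Rightarrow> 'e opath list \<Rightarrow> 'e opath set" where
  "cap_admissible T r \<chi> \<rho>s =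
     (boundary T r - set \<rho>s) \<union> {\<rho>. \<exists>v. \<rho> \<in> leaf_paths_to T r v \<and> enat (count_list \<rho>s \<rho>) < \<chi> v}"

definition cap_tree_factorial ::
    "('v, 'e) pre_digraph \<Rightarrow> 'v \<Rightarrow> ('e \<Rightarrow> real) \<Rightarrow> ('v \<Rightarrow> enat) \<Rightarrow> nat \<rightharpoonup> real" where
  "cap_tree_factorial T r l \<chi> = factorial_seq (cap_admissible T r \<chi>) l"

section \<open>The locally finite component\<close>

definition lf_verts :: "('v, 'e) pre_digraph \<Rightarrow> 'v \<Rightarrow> 'v set" where
  "lf_verts T r = {v \<in> verts T. \<forall>p. pre_digraph.awalk T r p v \<longrightarrow>
       (\<forall>u\<in>set (pre_digraph.awalk_verts T r p). u \<noteq> v \<longrightarrow> finite_valence T u)}"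

definition lf_component :: "('v, 'e) pre_digraph \<Rightarrow> 'v \<Rightarrow> ('v, 'e) pre_digraph" where
  "lf_component T r = T \<restriction> lf_verts T r"

definition lf_length :: "('v, 'e) pre_digraph \<Rightarrow> 'v \<Rightarrow> ('e \<Rightarrow> real) \<Rightarrow> 'e \<Rightarrow> real" where
  "lf_length T r l = restrict l (arcs (lf_component T r))"

text \<open>
  Only the values at leaves of the locally finite component are relevant; the valence is taken
  in the whole tree \<open>T\<close>.
\<close>

definition lf_capacity :: "('v, 'e) pre_digraph \<Rightarrow> 'v \<Rightarrow> enat" where
  "lf_capacity T v = (if finite_valence T v then 1 else \<infinity>)"

text \<open>
  The locally finite component is again a rooted tree with the same root and is locally finite, so
  the factorials with capacity are applied to it within their intended scope.
\<close>

context rooted_tree begin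

lemma uniq: "awalk r p v \<Longrightarrow> awalk r q v \<Longrightarrow> p = q"
  using unique_awalk[of v] awalk_last_in_verts by blast

lemma lf_snoc:
  assumes e: "e \<in> arcs T"
  shows "head T e \<in> lf_verts T r \<longleftrightarrow> tail T e \<in> lf_verts T r \<and> finite_valence T (tail T e)"
proof -
  obtain p where p: "awalk r p (tail T e)" using e unique_awalk tail_in_verts by blast
  have q: "awalk r (p @ [e]) (head T e)"
    using p e by (auto simp: awalk_append_iff awalk_Cons_iff awalk_Nil_iff)
  have vs: "set (awalk_verts r (p @ [e])) = insert (head T e) (set (awalk_verts r p))"
    using p by (auto simp: awalk_verts_conv)
  have notin: "head T e \<notin> set (awalk_verts r p)"
  proof
    assume "head T e \<in> set (awalk_verts r p)"
    then obtain q1 q2 where "p = q1 @ q2" "awalk r q1 (head T e)"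
      using awalk_decomp[OF p] by metis
    then show False using uniq[OF q] by fastforce
  qed
  have last: "tail T e \<in> set (awalk_verts r p)"
    using p by (metis awalk_verts_non_Nil awlast_if_cas awalkE' last_in_set awalk_def)
  have "head T e \<in> lf_verts T r \<longleftrightarrow> (\<forall>u\<in>set (awalk_verts r p). finite_valence T u)"
  proof -
    have "(\<forall>p'. awalk r p' (head T e) \<longrightarrow> (\<forall>u\<in>set (awalk_verts r p'). u \<noteq> head T e \<longrightarrow> finite_valence T u))
      \<longleftrightarrow> (\<forall>u\<in>set (awalk_verts r (p@[e])). u \<noteq> head T e \<longrightarrow> finite_valence T u)"
      using uniq[OF q] q by metis
    then show ?thesis unfolding lf_verts_def vs using e notin by auto
  qed
  moreover have "tail T e \<in> lf_verts T r \<longleftrightarrow> (\<forall>u\<in>set (awalk_verts r p). u \<noteq> tail T e \<longrightarrow> finite_valence T u)"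
    unfolding lf_verts_def using uniq[OF p] p e tail_in_verts[OF e] by blast
  ultimately show ?thesis using last by auto
qed

lemma r_lf: "r \<in> lf_verts T r"
proof -
  have "p = []" if "awalk r p r" for p using uniq[OF that, of "[]"] root_in_verts by (simp add: awalk_Nil_iff)
  then show ?thesis using root_in_verts by (fastforce simp: lf_verts_def)
qed

lemma walk_lf: "awalk r p v \<Longrightarrow> v \<in> lf_verts T r \<Longrightarrow> pre_digraph.awalk (lf_component T r) r p v"
proof (induction p arbitrary: v rule: rev_induct)
  case Nil
  then show ?case using r_lf by (auto simp: pre_digraph.awalk_def lf_component_def pre_digraph.cas.simps)
next
  case (snoc e p)
  interpret S: wf_digraph "lf_component T r" unfolding lf_component_def by auto
  have *: "awalk r p (tail T e)" "e \<in> arcs T" "head T e = v"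
    using snoc.prems by (auto simp: awalk_append_iff awalk_Cons_iff awalk_Nil_iff)
  then have t: "tail T e \<in> lf_verts T r" using lf_snoc snoc.prems by auto
  have "S.awalk (tail T e) [e] v" using * t snoc.prems(2)
    by (auto simp: pre_digraph.awalk_def pre_digraph.cas.simps lf_component_def)
  then show ?case using S.awalk_appendI[OF snoc.IH[OF *(1) t]] by simp
qed

theorem rooted_tree_lf_component: "rooted_tree (lf_component T r) r"
proof -
  interpret S: wf_digraph "lf_component T r" unfolding lf_component_def by auto
  have sub: "subgraph (lf_component T r) T"
    unfolding lf_component_def 
    by (rule subgraphI) (auto simp: lf_verts_def compatible_def intro: wf_digraph)
  show ?thesis
  proof
    show "r \<in> verts (lf_component T r)" using r_lf by (simp add: lf_component_def)
    fix v assume "v \<in> verts (lf_component T r)"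
    then have v: "v \<in> lf_verts T r" "v \<in> verts T" by (auto simp: lf_component_def lf_verts_def)
    then obtain p where p: "awalk r p v" using unique_awalk by blast
    show "\<exists>!p. S.awalk r p v"
    proof (rule ex1I)
      show "S.awalk r p v" using walk_lf p v by auto
      fix q assume "S.awalk r q v"
      then show "q = p" using subgraph_awalk_imp_awalk[OF _ sub] uniq p by blast
    qed
  qed
qed

theorem locally_finite_lf_component: "locally_finite (lf_component T r)"
  unfolding locally_finite_def
proof
  fix v assume "v \<in> verts (lf_component T r)"
  then have v: "v \<in> lf_verts T r" by (simp add: lf_component_def)
  show "finite_valence (lf_component T r) v"
  proof (cases "finite_valence T v")
    case True
    then show ?thesis unfolding finite_valence_def
      by (rule rev_finite_subset) (auto simp: incident_arcs_def in_arcs_def out_arcs_def lf_component_def)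
  next
    case False
    have "out_arcs (lf_component T r) v = {}"
      using False lf_snoc by (auto simp: out_arcs_def lf_component_def)
    moreover have "e = e'" if m: "e \<in> in_arcs T v" "e' \<in> in_arcs T v" for e e'
    proof -
      obtain p where "awalk r p (tail T e)" using m(1) unique_awalk[of "tail T e"] tail_in_verts[of e] unfolding in_arcs_def by blast
      then have 1: "awalk r (p@[e]) v" using m by (intro awalk_appendI) (auto simp: awalk_Cons_iff awalk_Nil_iff in_arcs_def)
      obtain p' where "awalk r p' (tail T e')" using m unique_awalk[of "tail T e'"] tail_in_verts[of "e'"] by (auto simp: in_arcs_def)
      then have 2: "awalk r (p'@[e']) v" using m by (intro awalk_appendI) (auto simp: awalk_Cons_iff awalk_Nil_iff in_arcs_def)
      show ?thesis using uniq[OF 1 2] by auto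
    qed
    then have "in_arcs T v \<subseteq> {SOME e. e \<in> in_arcs T v}"
      by (metis singletonI someI_ex subsetI)
    then have "finite (in_arcs T v)"
      using finite_subset by blast
    then have "finite (in_arcs (lf_component T r) v)"
      by (rule rev_finite_subset) (auto simp: in_arcs_def lf_component_def)
    ultimately show ?thesis by (simp add: finite_valence_def incident_arcs_def)
  qed
qed

end

end

(* Truncate every path of T at its first vertex of infinite valence.  This maps paths of T to paths
   of the locally finite component T_0 and does not increase pairings.  Conversely, a path of T_0
   that may still be chosen lifts to an unchosen path of T with the same pairing sum: if it ends at
   a vertex of infinite valence, extend it through an outgoing arc used by none of the finitely many
   chosen paths.  Hence truncation matches the greedy runs on T with those on T_0, value by value;
   the independence of the choices is not needed. *)

theory Submission
  imports Defs "HOL-Library.Sublist"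
begin

lemma greedy_snoc_iff:
  "greedy adm l (\<rho>s @ [\<rho>]) \<longleftrightarrow> greedy adm l \<rho>s \<and> is_arg_min (pairing_sum l \<rho>s) (\<lambda>\<rho>. \<rho> \<in> adm \<rho>s) \<rho>"
  using greedy.simps[of adm l "\<rho>s @ [\<rho>]"] by auto

section \<open>Initial segments of paths\<close>

text \<open>Reduces leaf paths and rays to finite lists, so that uniqueness of walks from the root
  applies to both.\<close>

fun initial_segment :: "'e list \<Rightarrow> 'e opath \<Rightarrow> bool" where
  "initial_segment xs (Leaf_Path p) \<longleftrightarrow> prefix xs p"
| "initial_segment xs (Ray f) \<longleftrightarrow> xs = map f [0..<length xs]"

lemma initial_segment_set: "initial_segment xs \<rho> \<Longrightarrow> set xs \<subseteq> path_arcs \<rho>"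
proof (cases \<rho>)
  case (Ray f)
  assume "initial_segment xs \<rho>"
  then have "xs = map f [0..<length xs]" using Ray by simp
  then have "set xs = f ` {0..<length xs}" by (metis set_map set_upt)
  then show ?thesis using Ray by auto
qed (auto dest: set_mono_prefix)

text \<open>Comparability makes the arc by which a path leaves \<open>T0\<close>, or leaves a given
  vertex, unique.\<close>

lemma initial_segment_linear:
  assumes "initial_segment xs \<rho>" "initial_segment ys \<rho>"
  shows "prefix xs ys \<or> prefix ys xs"
proof (cases \<rho>)
  case (Leaf_Path p)
  then show ?thesis using assms prefix_same_cases by auto
next
  case (Ray f)
  have "prefix (map f [0..<m]) (map f [0..<n])" if "m \<le> n" for m n
    using that by (metis le_add_diff_inverse map_mono_prefix prefixI upt_add_eq_append zero_le)
  then show ?thesis using assms Ray by (metis initial_segment.simps(2) linear)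
qed

lemma initial_segment_prefix:
  assumes "initial_segment ys \<rho>" "prefix xs ys"
  shows "initial_segment xs \<rho>"
proof (cases \<rho>)
  case (Leaf_Path p)
  then show ?thesis using assms prefix_order.trans by auto
next
  case (Ray f)
  have "xs = take (length xs) ys" using assms(2) by (auto simp: prefix_def)
  also have "ys = map f [0..<length ys]" using assms(1) Ray by simp
  finally have "xs = map f [0..<min (length xs) (length ys)]"
    by (metis (no_types, lifting) append.simps(1) assms(2) length_map length_upt diff_zero
        min.absorb1 prefix_length_le take_map take_upt add_0)
  then show ?thesis using Ray assms(2) prefix_length_le by (metis initial_segment.simps(2) min.absorb1)
qed

context rooted_tree begin

section \<open>Arcs, walks and leaves of a rooted tree\<close>

lemma awalk_snoc_iff: "awalk u (p @ [e]) v \<longleftrightarrow> awalk u p (tail T e) \<and> e \<in> arcs T \<and> head T e = v"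
  by (auto simp: awalk_append_iff awalk_Cons_iff awalk_Nil_iff)

text \<open>Appending each arc to the walk to its tail gives two walks from the root to one vertex;
  they coincide, hence so do their last arcs.\<close>

lemma in_arc_unique: "e \<in> arcs T \<Longrightarrow> e' \<in> arcs T \<Longrightarrow> head T e = head T e' \<Longrightarrow> e = e'"
  using uniq unique_awalk tail_in_verts awalk_snoc_iff by (metis last_snoc)

lemma awalk_tailE:
  assumes "e \<in> arcs T"
  obtains p where "awalk r p (tail T e)"
  using assms unique_awalk tail_in_verts by blast

lemma head_neq_root: "e \<in> arcs T \<Longrightarrow> head T e \<noteq> r"
  by (metis awalk_tailE awalk_snoc_iff awalk_Nil_iff root_in_verts snoc_eq_iff_butlast uniq)

text \<open>A vertex other than the root has exactly one incoming arc, so valence one leaves no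
  outgoing arc. For the root, every nonempty walk starts with an outgoing arc, so having none means
  being the only vertex. This removes the special role of the root from later arguments.\<close>

lemma leaves_eq: "leaves T r = {v \<in> verts T. out_arcs T v = {}}"
proof -
  have root: "verts T = {r} \<longleftrightarrow> out_arcs T r = {}"
  proof
    assume "verts T = {r}"
    then show "out_arcs T r = {}" using head_in_verts head_neq_root by fastforce
  next
    assume o: "out_arcs T r = {}"
    have "v = r" if "v \<in> verts T" for v
    proof -
      obtain p where "awalk r p v" using unique_awalk \<open>v \<in> verts T\<close> by blast
      then show ?thesis using o by (cases p) (auto simp: awalk_Cons_iff awalk_Nil_iff out_arcs_def)
    qed
    then show "verts T = {r}" using root_in_verts by blast
  qed
  have other: "card (incident_arcs T v) = 1 \<longleftrightarrow> out_arcs T v = {}" if v: "v \<in> verts T" "v \<noteq> r" for v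
  proof -
    obtain p where p: "awalk r p v" using unique_awalk v by blast
    have "p \<noteq> []" using p v by (auto simp: awalk_Nil_iff)
    then obtain q e where "p = q @ [e]" by (metis rev_exhaust)
    then have e: "e \<in> arcs T" "head T e = v" "awalk r q (tail T e)" using p awalk_snoc_iff by auto
    then have i: "in_arcs T v = {e}" using in_arc_unique by (auto simp: in_arcs_def)
    \<comment> \<open>Since \<open>e\<close> is not a loop, it is not outgoing, and any outgoing arc
      would be a second incident arc.\<close>
    have "tail T e \<noteq> v"
    proof
      assume "tail T e = v"
      then have "q = p" using uniq[OF p] e(3) by auto
      then show False using \<open>p = q @ [e]\<close> by auto
    qed
    then have "e \<notin> out_arcs T v" by auto
    then show ?thesis unfolding incident_arcs_def i
      by (auto simp: card_1_singleton_iff)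
  qed
  show ?thesis unfolding leaves_def using root other root_in_verts
    by (cases "verts T = {r}") auto
qed

section \<open>Boundary paths and their common arcs\<close>

lemma ray_awalk:
  assumes "Ray f \<in> boundary T r"
  shows "awalk r (map f [0..<n]) (tail T (f n))"
proof (induction n)
  case 0
  then show ?case using assms root_in_verts by (auto simp: boundary_def awalk_Nil_iff)
next
  case (Suc n)
  have "awalk r (map f [0..<n] @ [f n]) (tail T (f (Suc n)))"
    unfolding awalk_snoc_iff using Suc assms by (auto simp: boundary_def)
  then show ?case by simp
qed

lemma ext_boundaryE:
  assumes "\<rho> \<in> ext_boundary T r"
  obtains f where "\<rho> = Ray f" "Ray f \<in> boundary T r"
  | p v where "\<rho> = Leaf_Path p" "awalk r p v" "v \<in> leaves T r"
  using assms unfolding ext_boundary_def leaf_paths_to_def boundary_def by blast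

lemma path_arc_awalk:
  assumes "\<rho> \<in> ext_boundary T r" "e \<in> path_arcs \<rho>"
  obtains p where "awalk r (p @ [e]) (head T e)" "initial_segment (p @ [e]) \<rho>"
  using assms(1)
proof (cases rule: ext_boundaryE)
  case (1 f)
  then obtain n where "e = f n" using assms(2) by auto
  then have "awalk r (map f [0..<n] @ [e]) (head T e)"
    unfolding awalk_snoc_iff using ray_awalk[OF 1(2)] 1 by (auto simp: boundary_def)
  moreover have "initial_segment (map f [0..<n] @ [e]) \<rho>" using 1 \<open>e = f n\<close> by simp
  ultimately show ?thesis by (rule that)
next
  case (2 p v)
  then obtain xs ys where p: "p = xs @ e # ys" using assms(2) by (metis path_arcs.simps(1) split_list)
  then have "awalk r ((xs @ [e]) @ ys) v" using 2 by simp
  then have "awalk r (xs @ [e]) (head T e)" by (metis awalk_append_iff awalk_snoc_iff)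
  moreover have "initial_segment (xs @ [e]) \<rho>" using 2 p by simp
  ultimately show ?thesis by (rule that)
qed

lemma path_arcs_subset: "\<rho> \<in> ext_boundary T r \<Longrightarrow> path_arcs \<rho> \<subseteq> arcs T"
  by (metis path_arc_awalk awalk_snoc_iff subsetI)

text \<open>The path reaches \<open>head T e\<close> by some walk from the root, and there is only
  one. Hence paths that share an arc share everything before it.\<close>

lemma initial_segment_awalk:
  assumes "\<rho> \<in> ext_boundary T r" "e \<in> path_arcs \<rho>" "awalk r (p @ [e]) v"
  shows "initial_segment (p @ [e]) \<rho>"
  by (metis assms path_arc_awalk awalk_snoc_iff uniq)

text \<open>If \<open>f j = g k\<close>, the walks to the common tail agree, so \<open>j = k\<close>
  and the rays coincide before \<open>j\<close>; thus \<open>j\<close> cannot exceed an index where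
  they differ. Finiteness keeps the sum in \<open>pairing\<close> away from its default
  value.\<close>

lemma finite_common_arcs:
  assumes "\<rho> \<in> ext_boundary T r" "\<tau> \<in> ext_boundary T r" "\<rho> \<noteq> \<tau>"
  shows "finite (path_arcs \<rho> \<inter> path_arcs \<tau>)"
proof (cases "(\<exists>p. \<rho> = Leaf_Path p) \<or> (\<exists>p. \<tau> = Leaf_Path p)")
  case True
  then show ?thesis by auto
next
  case False
  then obtain f g where fg: "\<rho> = Ray f" "\<tau> = Ray g" "Ray f \<in> boundary T r" "Ray g \<in> boundary T r"
    using assms by (metis ext_boundaryE)
  then obtain i where i: "f i \<noteq> g i" using assms by auto
  have "j \<le> i" if "f j = g k" for j k
  proof (rule ccontr)
    assume "\<not> j \<le> i"
    have eq: "map f [0..<j] = map g [0..<k]"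
      using uniq[OF ray_awalk[OF fg(3), of j]] ray_awalk[OF fg(4), of k] that by auto
    then have "j = k" by (metis diff_zero length_map length_upt)
    then show False using eq i \<open>\<not> j \<le> i\<close> by auto
  qed
  then have "range f \<inter> range g \<subseteq> f ` {..i}" by auto
  then have "finite (range f \<inter> range g)" by (rule finite_subset) simp
  then show ?thesis using fg by simp
qed

text \<open>Either a vertex without outgoing arcs is reachable from \<open>v\<close>, which gives a
  leaf path, or one can move on forever, which gives a ray.\<close>

lemma extend_awalk:
  assumes p: "awalk r p v"
  obtains \<rho> where "\<rho> \<in> ext_boundary T r" "initial_segment p \<rho>"
proof (cases "\<exists>q w. awalk v q w \<and> out_arcs T w = {}")
  case True
  then obtain q w where q: "awalk v q w" "out_arcs T w = {}" by blast
  then have "awalk r (p @ q) w" "w \<in> leaves T r" using p leaves_eq awalk_last_in_verts by auto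
  then have "Leaf_Path (p @ q) \<in> ext_boundary T r" by (auto simp: ext_boundary_def leaf_paths_to_def)
  then show ?thesis using that by force
next
  case False
  \<comment> \<open>\<open>c\<close> selects an outgoing arc at each vertex, \<open>u\<close>
    iterates this selection from \<open>v\<close>, and \<open>f\<close> runs through
    \<open>p\<close> and then through the selected arcs.\<close>
  define c where "c u = (SOME e. e \<in> out_arcs T u)" for u
  define u where "u n = ((\<lambda>x. head T (c x)) ^^ n) v" for n
  define f where "f i = (if i < length p then p ! i else c (u (i - length p)))" for i
  have c: "c w \<in> arcs T \<and> tail T (c w) = w" if "awalk v q w" for q w
    using False that someI_ex[of "\<lambda>e. e \<in> out_arcs T w"] unfolding c_def by fastforce
  have walk: "\<exists>q. awalk v q (u n)" for n
  proof (induction n)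
    case 0
    have "awalk v [] v" using awalk_last_in_verts[OF p] by (simp add: awalk_Nil_iff)
    then show ?case by (auto simp: u_def)
  next
    case (Suc n)
    then obtain q where "awalk v q (u n)" by blast
    then have "awalk v (q @ [c (u n)]) (u (Suc n))"
      unfolding awalk_snoc_iff using c by (simp add: u_def)
    then show ?case by blast
  qed
  have pre: "map f [0..<n] = take n p" if "n \<le> length p" for n
    using that by (auto simp: f_def list_eq_iff_nth_eq)
  have aw: "awalk r (map f [0..<length p + n]) (u n)" for n
  proof (induction n)
    case 0
    then show ?case using p pre[of "length p"] by (simp add: u_def)
  next
    case (Suc n)
    moreover obtain q where "awalk v q (u n)" using walk by blast
    ultimately have "awalk r (map f [0..<length p + n] @ [c (u n)]) (u (Suc n))"
      unfolding awalk_snoc_iff using c by (simp add: u_def)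
    moreover have "f (length p + n) = c (u n)" by (simp add: f_def)
    ultimately show ?case by simp
  qed
  have step: "f i \<in> arcs T \<and> head T (f i) = tail T (f (Suc i))" for i
  proof -
    \<comment> \<open>Both arcs are placed inside one walk given by \<open>aw\<close>, so adjacency
      needs no case split at the junction of \<open>p\<close> with its continuation.\<close>
    have "map f [0..<length p + Suc (Suc i)] =
        (map f [0..<i] @ [f i] @ [f (Suc i)]) @ map f [Suc (Suc i)..<length p + Suc (Suc i)]"
    proof -
      have "[0..<length p + Suc (Suc i)] = [0..<Suc (Suc i)] @ [Suc (Suc i)..<length p + Suc (Suc i)]"
        by (metis add.commute upt_add_eq_append zero_le)
      then show ?thesis by (simp only: map_append) simp
    qed
    then show ?thesis using aw[of "Suc (Suc i)"]
      by (simp add: awalk_append_iff awalk_Cons_iff)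
  qed
  have "tail T (f 0) = r"
  proof -
    \<comment> \<open>One arc beyond \<open>p\<close> is taken so that the walk has a first arc even
      when \<open>p\<close> is empty.\<close>
    have "[0..<length p + Suc 0] = 0 # [Suc 0..<length p + Suc 0]" 
      using upt_conv_Cons[of 0 "length p + Suc 0"] by simp
    then have "awalk r (f 0 # map f [Suc 0..<length p + Suc 0]) (u (Suc 0))"
      using aw[of "Suc 0"] by (simp only: list.map)
    then show ?thesis by (simp add: awalk_Cons_iff)
  qed
  then have "Ray f \<in> ext_boundary T r" using step by (auto simp: ext_boundary_def boundary_def)
  moreover have "initial_segment p (Ray f)" using pre[of "length p"] by simp
  ultimately show ?thesis by (rule that)
qed

section \<open>Truncation to the locally finite component\<close>

abbreviation (input) T0 where "T0 \<equiv> lf_component T r"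

lemma lf_component_simps [simp]:
  "tail T0 = tail T" "head T0 = head T" "verts T0 = lf_verts T r"
  by (auto simp: lf_component_def)

text \<open>By \<open>lf_snoc\<close>, whether the head belongs to the component is decided at the
  tail. So a path can leave \<open>T0\<close> only at a vertex of infinite valence.\<close>

lemma lf_arcs_iff:
  "e \<in> arcs T0 \<longleftrightarrow> e \<in> arcs T \<and> tail T e \<in> lf_verts T r \<and> finite_valence T (tail T e)"
  using lf_snoc[of e] by (auto simp: lf_component_def)

lemma lf_awalk_iff: "pre_digraph.awalk T0 r p v \<longleftrightarrow> awalk r p v \<and> set p \<subseteq> arcs T0"
proof
  assume w: "pre_digraph.awalk T0 r p v"
  have "subgraph T0 T" unfolding lf_component_def
    by (rule subgraphI) (auto simp: lf_verts_def compatible_def intro: wf_digraph)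
  then have "awalk r p v" using subgraph_awalk_imp_awalk w by blast
  moreover have "set p \<subseteq> arcs T0" using w by (simp add: pre_digraph.awalk_def)
  ultimately show "awalk r p v \<and> set p \<subseteq> arcs T0" ..
next
  assume a: "awalk r p v \<and> set p \<subseteq> arcs T0"
  have "v \<in> lf_verts T r"
  proof (cases p rule: rev_cases)
    case Nil
    then show ?thesis using a r_lf by (simp add: awalk_Nil_iff)
  next
    case (snoc q e)
    then show ?thesis using a by (auto simp: awalk_snoc_iff lf_component_def)
  qed
  then show "pre_digraph.awalk T0 r p v" using a walk_lf by blast
qed

lemma lf_awalk_last: "pre_digraph.awalk T0 r p v \<Longrightarrow> v \<in> lf_verts T r"
  by (metis lf_component_simps(3) rooted_tree.axioms(1) rooted_tree_lf_component
      wf_digraph.awalk_last_in_verts)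

text \<open>The walk to a vertex of the component stays inside it; hence the arcs of
  \<open>T0\<close> on a path come before all its other arcs.\<close>

lemma lf_awalk_arc: "awalk r (p @ [e]) v \<Longrightarrow> e \<in> arcs T0 \<Longrightarrow> set (p @ [e]) \<subseteq> arcs T0"
  by (metis awalk_snoc_iff lf_arcs_iff lf_awalk_iff lf_snoc walk_lf)

lemma lf_boundary_iff: "\<rho> \<in> boundary T0 r \<longleftrightarrow> \<rho> \<in> boundary T r \<and> path_arcs \<rho> \<subseteq> arcs T0"
proof -
  have "arcs T0 \<subseteq> arcs T" by (auto simp: lf_component_def)
  then show ?thesis unfolding boundary_def lf_component_simps by fastforce
qed

text \<open>A vertex of the component keeps all its outgoing arcs if its valence is finite and loses
  all of them otherwise.\<close>

lemma lf_leaves_eq: "leaves T0 r = {v \<in> lf_verts T r. out_arcs T v = {} \<or> \<not> finite_valence T v}"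
proof -
  interpret S: rooted_tree T0 r by (rule rooted_tree_lf_component)
  show ?thesis unfolding S.leaves_eq by (auto simp: lf_arcs_iff out_arcs_def)
qed

lemma lf_leaf_paths_iff:
  "Leaf_Path p \<in> leaf_paths_to T0 r v \<longleftrightarrow>
     awalk r p v \<and> set p \<subseteq> arcs T0 \<and> (out_arcs T v = {} \<or> \<not> finite_valence T v)"
proof -
  have "Leaf_Path p \<in> leaf_paths_to T0 r v \<longleftrightarrow> v \<in> leaves T0 r \<and> pre_digraph.awalk T0 r p v"
    by (simp add: leaf_paths_to_def)
  then show ?thesis unfolding lf_leaves_eq using lf_awalk_last lf_awalk_iff by blast
qed

text \<open>Ensures that \<open>lf_capacity\<close> gives capacity 1, never \<infinity>, to the
  leaves of \<open>T\<close>.\<close>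

lemma finite_valence_leaf:
  assumes "v \<in> verts T" "out_arcs T v = {}"
  shows "finite_valence T v"
proof -
  have "v \<in> leaves T r" using assms leaves_eq by blast
  moreover have "finite_valence T r" if "verts T = {r}"
  proof -
    have "arcs T = {}" using that head_in_verts head_neq_root by fastforce
    then show ?thesis by (simp add: finite_valence_def incident_arcs_def in_arcs_def out_arcs_def)
  qed
  ultimately show ?thesis unfolding leaves_def finite_valence_def
    by (auto split: if_splits intro: card_ge_0_finite)
qed

text \<open>Infinite valence therefore means infinitely many outgoing arcs, the supply of fresh arcs
  for lifting.\<close>

lemma finite_in_arcs: "finite (in_arcs T v)"
proof (cases "in_arcs T v = {}")
  case False
  then obtain e where "in_arcs T v = {e}" using in_arc_unique by (auto simp: in_arcs_def)
  then show ?thesis by simp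
qed simp

text \<open>The description cuts the path just before its first arc \<open>e\<close> outside
  \<open>T0\<close>. A ray that leaves \<open>T0\<close> thus becomes a leaf path.\<close>

definition lf_truncate :: "'e opath \<Rightarrow> 'e opath" where
  "lf_truncate \<rho> = (if path_arcs \<rho> \<subseteq> arcs T0 then \<rho>
     else Leaf_Path (THE p. \<exists>e. initial_segment (p @ [e]) \<rho> \<and> set p \<subseteq> arcs T0 \<and> e \<notin> arcs T0))"

lemma truncate_id: "path_arcs \<rho> \<subseteq> arcs T0 \<Longrightarrow> lf_truncate \<rho> = \<rho>"
  by (simp add: lf_truncate_def)

text \<open>Two exit segments of one path are comparable; if one were strictly shorter, its exit arc
  would lie in the part of the other inside \<open>T0\<close>.\<close>

lemma truncate_eqI:
  assumes "initial_segment (p @ [e]) \<rho>" "set p \<subseteq> arcs T0" "e \<notin> arcs T0"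
  shows "lf_truncate \<rho> = Leaf_Path p"
proof -
  have n: "\<not> path_arcs \<rho> \<subseteq> arcs T0" using initial_segment_set[OF assms(1)] assms(3) by auto
  have "q = p" if q: "initial_segment (q @ [e']) \<rho>" "set q \<subseteq> arcs T0" "e' \<notin> arcs T0" for q e'
  proof -
    have *: "xs = ys" if "prefix (xs @ [x]) (ys @ [y])" "set ys \<subseteq> arcs T0" "x \<notin> arcs T0" for xs ys x y
    proof (rule ccontr)
      assume "xs \<noteq> ys"
      then have "prefix (xs @ [x]) ys" using that(1) by (metis butlast_snoc prefix_snoc)
      then show False using that set_mono_prefix by fastforce
    qed
    show ?thesis using initial_segment_linear[OF q(1) assms(1)] * q assms by metis
  qed
  then have "(THE p. \<exists>e. initial_segment (p @ [e]) \<rho> \<and> set p \<subseteq> arcs T0 \<and> e \<notin> arcs T0) = p"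
    using assms by (intro the_equality) blast+
  then show ?thesis using n by (simp add: lf_truncate_def)
qed

text \<open>Take the first arc outside \<open>T0\<close>. Its tail is reached through arcs of
  \<open>T0\<close>, so it lies in the component, and only infinite valence there can exclude the
  arc.\<close>

lemma exit_segment:
  assumes "\<rho> \<in> ext_boundary T r" "\<not> path_arcs \<rho> \<subseteq> arcs T0"
  obtains p e where "initial_segment (p @ [e]) \<rho>" "set p \<subseteq> arcs T0" "e \<notin> arcs T0"
    "awalk r p (tail T e)" "\<not> finite_valence T (tail T e)"
proof -
  obtain e' where e': "e' \<in> path_arcs \<rho>" "e' \<notin> arcs T0" using assms(2) by blast
  obtain q where q: "awalk r (q @ [e']) (head T e')" "initial_segment (q @ [e']) \<rho>"
    using path_arc_awalk[OF assms(1) e'(1)] by blast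
  have "\<exists>x\<in>set (q @ [e']). x \<notin> arcs T0" using e' by simp
  from split_list_first_prop[OF this] obtain p e ys
    where p: "q @ [e'] = p @ e # ys" "e \<notin> arcs T0" "set p \<subseteq> arcs T0" by blast
  have i: "initial_segment (p @ [e]) \<rho>"
    by (rule initial_segment_prefix[OF q(2)]) (simp add: p(1))
  have "awalk r ((p @ [e]) @ ys) (head T e')" using q(1) p(1) by simp
  then have a: "awalk r p (tail T e)" "e \<in> arcs T"
    by (metis awalk_append_iff awalk_snoc_iff)+
  then have "tail T e \<in> lf_verts T r" using lf_awalk_iff lf_awalk_last p(3) by blast
  then have "\<not> finite_valence T (tail T e)" using p(2) a(2) lf_arcs_iff by blast
  then show ?thesis using that i p a by blast
qed

lemma truncate_cases:
  assumes "\<rho> \<in> ext_boundary T r"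
  obtains "path_arcs \<rho> \<subseteq> arcs T0" "lf_truncate \<rho> = \<rho>"
  | p v where "lf_truncate \<rho> = Leaf_Path p" "awalk r p v" "set p \<subseteq> arcs T0" "\<not> finite_valence T v"
  using assms exit_segment truncate_eqI truncate_id by metis

text \<open>By \<open>lf_awalk_arc\<close> no arc of \<open>T0\<close> follows the exit arc, so
  cutting there loses only arcs outside \<open>T0\<close>.\<close>

lemma path_arcs_truncate:
  assumes "\<rho> \<in> ext_boundary T r"
  shows "path_arcs (lf_truncate \<rho>) = path_arcs \<rho> \<inter> arcs T0"
proof (cases "path_arcs \<rho> \<subseteq> arcs T0")
  case True
  then show ?thesis using truncate_id by auto
next
  case False
  from exit_segment[OF assms this] obtain p e
    where p: "initial_segment (p @ [e]) \<rho>" "set p \<subseteq> arcs T0" "e \<notin> arcs T0" by metis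
  have "g \<in> set p" if g: "g \<in> path_arcs \<rho>" "g \<in> arcs T0" for g
  proof -
    obtain q where q: "awalk r (q @ [g]) (head T g)" "initial_segment (q @ [g]) \<rho>"
      using path_arc_awalk[OF assms g(1)] by blast
    then have "set (q @ [g]) \<subseteq> arcs T0" using lf_awalk_arc g by blast
    then have "\<not> prefix (p @ [e]) (q @ [g])" using p(3) set_mono_prefix by fastforce
    then have "prefix (q @ [g]) (p @ [e])" using initial_segment_linear p(1) q(2) by blast
    then show ?thesis using p(3) g(2) set_mono_prefix by fastforce
  qed
  then show ?thesis
    using truncate_eqI[OF p] initial_segment_set[OF p(1)] p(2) by auto
qed

section \<open>Comparing the two greedy procedures\<close>

text \<open>Truncation merges distinct paths only at leaves of infinite capacity, where repetition
  is allowed. A ray, or a path to a leaf of \<open>T\<close>, can be the truncation of itself only,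
  so a new path stays new.\<close>

lemma truncate_admissible:
  assumes \<rho>s: "set \<rho>s \<subseteq> ext_boundary T r" and \<rho>: "\<rho> \<in> ext_boundary T r" "\<rho> \<notin> set \<rho>s"
  shows "lf_truncate \<rho> \<in> cap_admissible T0 r (lf_capacity T) (map lf_truncate \<rho>s)"
  using \<rho>(1)
proof (cases rule: truncate_cases)
  case 1
  show ?thesis using \<rho>(1)
  proof (cases rule: ext_boundaryE)
    case (1 f)
    have "Ray f \<notin> lf_truncate ` set \<rho>s"
    proof
      assume "Ray f \<in> lf_truncate ` set \<rho>s"
      then obtain \<tau> where \<tau>: "\<tau> \<in> set \<rho>s" "Ray f = lf_truncate \<tau>" by blast
      then have "\<tau> \<in> ext_boundary T r" using \<rho>s by blast
      then show False using \<tau> 1 \<rho> by (cases rule: truncate_cases) auto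
    qed
    then show ?thesis using \<open>lf_truncate \<rho> = \<rho>\<close> \<open>path_arcs \<rho> \<subseteq> arcs T0\<close> 1
      by (simp add: cap_admissible_def lf_boundary_iff)
  next
    case (2 p v)
    then have v: "out_arcs T v = {}" "v \<in> verts T" using leaves_eq by auto
    have fin: "finite_valence T v" using finite_valence_leaf v by blast
    \<comment> \<open>A path truncating to \<rho> is \<rho> itself or was cut at a vertex of
      infinite valence, which \<open>v\<close> is not.\<close>
    have "\<rho> \<notin> lf_truncate ` set \<rho>s"
    proof
      assume "\<rho> \<in> lf_truncate ` set \<rho>s"
      then obtain \<tau> where \<tau>: "\<tau> \<in> set \<rho>s" "\<rho> = lf_truncate \<tau>" by blast
      then have "\<tau> \<in> ext_boundary T r" using \<rho>s by blast
      then show False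
      proof (cases rule: truncate_cases)
        case 1
        then show ?thesis using \<tau> \<rho> by auto
      next
        case (2 p' v')
        then have "awalk r p v'" using \<tau> \<open>\<rho> = Leaf_Path p\<close> by auto
        then have "v' = v" using \<open>awalk r p v\<close> by (metis awalk_ends)
        then show ?thesis using fin 2 by simp
      qed
    qed
    then have "count_list (map lf_truncate \<rho>s) \<rho> = 0" by (simp add: count_list_0_iff)
    moreover have "\<rho> \<in> leaf_paths_to T0 r v"
      using 2 v \<open>path_arcs \<rho> \<subseteq> arcs T0\<close> by (simp add: lf_leaf_paths_iff)
    ultimately show ?thesis using \<open>lf_truncate \<rho> = \<rho>\<close> fin
      by (auto simp: cap_admissible_def lf_capacity_def zero_enat_def[symmetric] intro!: exI[of _ v])
  qed
next
  case (2 p v)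
  then have "lf_truncate \<rho> \<in> leaf_paths_to T0 r v" by (simp add: lf_leaf_paths_iff)
  then show ?thesis using 2 by (auto simp: cap_admissible_def lf_capacity_def intro!: exI[of _ v])
qed

text \<open>Rays and paths to leaves of \<open>T\<close> lift to themselves; work is needed only at
  a vertex of infinite valence. The last conclusion says that the lift adds nothing to the pairings
  beyond the arcs of \<open>T0\<close>.\<close>

lemma lift_admissible:
  assumes \<rho>s: "set \<rho>s \<subseteq> ext_boundary T r"
    and \<sigma>: "\<sigma> \<in> cap_admissible T0 r (lf_capacity T) (map lf_truncate \<rho>s)"
  obtains \<rho> where "\<rho> \<in> ext_boundary T r" "\<rho> \<notin> set \<rho>s" "lf_truncate \<rho> = \<sigma>"
    "\<And>\<tau>. \<tau> \<in> set \<rho>s \<Longrightarrow> path_arcs \<rho> \<inter> path_arcs \<tau> \<subseteq> arcs T0"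
proof -
  consider "\<sigma> \<in> boundary T0 r" "\<sigma> \<notin> lf_truncate ` set \<rho>s"
    | v where "\<sigma> \<in> leaf_paths_to T0 r v" "enat (count_list (map lf_truncate \<rho>s) \<sigma>) < lf_capacity T v"
    using \<sigma> by (auto simp: cap_admissible_def)
  then show ?thesis
  proof cases
    case 1
    then have s: "\<sigma> \<in> boundary T r" "path_arcs \<sigma> \<subseteq> arcs T0" using lf_boundary_iff by blast+
    then have "lf_truncate \<sigma> = \<sigma>" using truncate_id by blast
    then show ?thesis using that[of \<sigma>] s 1 by (metis UnI1 ext_boundary_def imageI le_infI1)
  next
    case (2 v)
    then obtain p where p: "\<sigma> = Leaf_Path p" by (auto simp: leaf_paths_to_def)
    have w: "awalk r p v" "set p \<subseteq> arcs T0" "out_arcs T v = {} \<or> \<not> finite_valence T v"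
      using 2(1) p lf_leaf_paths_iff by auto
    show ?thesis
    proof (cases "finite_valence T v")
      case True
      then have "v \<in> leaves T r" using w awalk_last_in_verts leaves_eq by blast
      then have s: "\<sigma> \<in> ext_boundary T r" using w p by (auto simp: ext_boundary_def leaf_paths_to_def)
      have t: "lf_truncate \<sigma> = \<sigma>" using truncate_id w p by simp
      have "count_list (map lf_truncate \<rho>s) \<sigma> = 0"
        using 2(2) True by (simp add: lf_capacity_def one_enat_def)
      then have "\<sigma> \<notin> lf_truncate ` set \<rho>s" by (simp add: count_list_0_iff)
      then have "\<sigma> \<notin> set \<rho>s" using t by (metis imageI)
      then show ?thesis by (rule that[OF s _ t]) (use w p in auto)
    next
      case False
      have inf: "infinite (out_arcs T v)"
        using False finite_in_arcs by (auto simp: finite_valence_def incident_arcs_def)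
      \<comment> \<open>A path uses at most one arc out of \<open>v\<close>: two of them would give
        comparable initial segments of equal length, both extending \<open>p\<close>.\<close>
      have "finite (out_arcs T v \<inter> path_arcs \<tau>)" if "\<tau> \<in> set \<rho>s" for \<tau>
      proof -
        have \<tau>: "\<tau> \<in> ext_boundary T r" using that \<rho>s by blast
        have "e = e'" if "e \<in> out_arcs T v \<inter> path_arcs \<tau>" "e' \<in> out_arcs T v \<inter> path_arcs \<tau>" for e e'
        proof -
          have "initial_segment (p @ [x]) \<tau>" if "x \<in> out_arcs T v \<inter> path_arcs \<tau>" for x
            using that w(1) initial_segment_awalk[OF \<tau>, of x p "head T x"]
            unfolding awalk_snoc_iff by auto
          then show ?thesis using that initial_segment_linear[of "p @ [e]" \<tau> "p @ [e']"] by auto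
        qed
        then have "out_arcs T v \<inter> path_arcs \<tau> \<subseteq> {SOME e. e \<in> out_arcs T v \<inter> path_arcs \<tau>}"
          by (metis singletonI someI_ex subsetI)
        then show ?thesis using finite_subset by blast
      qed
      then have "finite (\<Union>\<tau>\<in>set \<rho>s. out_arcs T v \<inter> path_arcs \<tau>)" by blast
      then have "\<not> out_arcs T v \<subseteq> (\<Union>\<tau>\<in>set \<rho>s. out_arcs T v \<inter> path_arcs \<tau>)"
        using inf finite_subset by blast
      then obtain e where "e \<in> out_arcs T v" "e \<notin> (\<Union>\<tau>\<in>set \<rho>s. out_arcs T v \<inter> path_arcs \<tau>)"
        unfolding subset_iff by metis
      then have e: "e \<in> arcs T" "tail T e = v" "\<And>\<tau>. \<tau> \<in> set \<rho>s \<Longrightarrow> e \<notin> path_arcs \<tau>"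
        by auto
      have "awalk r (p @ [e]) (head T e)" unfolding awalk_snoc_iff using w e by simp
      then obtain \<rho> where \<rho>: "\<rho> \<in> ext_boundary T r" "initial_segment (p @ [e]) \<rho>"
        by (rule extend_awalk)
      have "e \<notin> arcs T0" using e False lf_arcs_iff by blast
      then have t: "lf_truncate \<rho> = \<sigma>" using truncate_eqI[OF \<rho>(2) w(2)] p by simp
      have "e \<in> path_arcs \<rho>" using initial_segment_set[OF \<rho>(2)] by simp
      then have new: "\<rho> \<notin> set \<rho>s" using e(3) by blast
      \<comment> \<open>A common arc \<open>g\<close> must precede \<open>e\<close> on \<rho>:
        otherwise \<tau>, which shares with \<rho> everything up to \<open>g\<close>, would contain
        \<open>e\<close>. So \<open>g\<close> lies on \<open>p\<close>.\<close>
      have "g \<in> arcs T0" if \<tau>: "\<tau> \<in> set \<rho>s" and g: "g \<in> path_arcs \<rho>" "g \<in> path_arcs \<tau>" for \<tau> g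
      proof -
        obtain q where q: "awalk r (q @ [g]) (head T g)" "initial_segment (q @ [g]) \<rho>"
          using path_arc_awalk[OF \<rho>(1) g(1)] by blast
        have "initial_segment (q @ [g]) \<tau>" using initial_segment_awalk q(1) g(2) \<tau> \<rho>s by blast
        then have "e \<notin> set (q @ [g])" using initial_segment_set[of "q @ [g]" \<tau>] e(3)[OF \<tau>] by blast
        then have "\<not> prefix (p @ [e]) (q @ [g])" using set_mono_prefix by fastforce
        then have "prefix (q @ [g]) (p @ [e])" using initial_segment_linear \<rho>(2) q(2) by blast
        then have "g \<in> set (p @ [e])" using set_mono_prefix by fastforce
        then show ?thesis using w(2) e(3)[OF \<tau>] g(2) by auto
      qed
      then show ?thesis using that[OF \<rho>(1) new t] by blast
    qed
  qed
qed

section \<open>Pairings and minimizers under truncation\<close>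

lemma pairing_truncate:
  assumes "\<rho> \<in> ext_boundary T r" "\<tau> \<in> ext_boundary T r"
  shows "pairing (lf_length T r l) (lf_truncate \<rho>) (lf_truncate \<tau>)
       = (\<Sum>e\<in>path_arcs \<rho> \<inter> path_arcs \<tau> \<inter> arcs T0. l e)"
  unfolding pairing_def path_arcs_truncate[OF assms(1)] path_arcs_truncate[OF assms(2)]
  \<comment> \<open>\<open>lf_length\<close> is \<open>undefined\<close> outside \<open>T0\<close>,
    but every summand lies in \<open>T0\<close>.\<close>
  by (rule sum.cong) (auto simp: lf_length_def)

text \<open>Truncation drops positive summands from a finite sum. Distinctness matters: a ray paired
  with itself has the default value 0, which its truncation may exceed.\<close>

lemma pairing_truncate_le:
  assumes "length_function T l" "\<rho> \<in> ext_boundary T r" "\<tau> \<in> ext_boundary T r" "\<rho> \<noteq> \<tau>"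
  shows "pairing (lf_length T r l) (lf_truncate \<rho>) (lf_truncate \<tau>) \<le> pairing l \<rho> \<tau>"
  unfolding pairing_truncate[OF assms(2,3)] unfolding pairing_def
proof (rule sum_mono2)
  fix e assume "e \<in> path_arcs \<rho> \<inter> path_arcs \<tau> - path_arcs \<rho> \<inter> path_arcs \<tau> \<inter> arcs T0"
  then have "e \<in> arcs T" using path_arcs_subset assms by blast
  then show "0 \<le> l e" using assms(1) by (simp add: length_function_def less_imp_le)
qed (use finite_common_arcs assms in auto)

lemma pairing_sum_truncate_le:
  assumes "length_function T l" "set \<rho>s \<subseteq> ext_boundary T r" "\<rho> \<in> ext_boundary T r" "\<rho> \<notin> set \<rho>s"
  shows "pairing_sum (lf_length T r l) (map lf_truncate \<rho>s) (lf_truncate \<rho>) \<le> pairing_sum l \<rho>s \<rho>"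
proof -
  have "\<rho>s ! j \<in> ext_boundary T r \<and> \<rho> \<noteq> \<rho>s ! j" if "j < length \<rho>s" for j
    using assms that nth_mem by blast
  then show ?thesis unfolding pairing_sum_def
    using assms by (auto intro!: sum_mono pairing_truncate_le)
qed

lemma pairing_sum_truncate_eq:
  assumes "set \<rho>s \<subseteq> ext_boundary T r" "\<rho> \<in> ext_boundary T r"
    and "\<And>\<tau>. \<tau> \<in> set \<rho>s \<Longrightarrow> path_arcs \<rho> \<inter> path_arcs \<tau> \<subseteq> arcs T0"
  shows "pairing_sum (lf_length T r l) (map lf_truncate \<rho>s) (lf_truncate \<rho>) = pairing_sum l \<rho>s \<rho>"
proof -
  have "pairing (lf_length T r l) (lf_truncate \<rho>) (lf_truncate \<tau>) = pairing l \<rho> \<tau>" if "\<tau> \<in> set \<rho>s" for \<tau>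
    using assms that pairing_truncate[of \<rho> \<tau>] by (simp add: pairing_def Int_absorb2 subset_iff)
  then show ?thesis by (simp add: pairing_sum_def)
qed

abbreviation (input) adm where "adm \<rho>s \<equiv> ext_boundary T r - set \<rho>s"
abbreviation (input) adm0 where "adm0 \<equiv> cap_admissible T0 r (lf_capacity T)"

lemma lift_pairing_sum:
  assumes "set \<rho>s \<subseteq> ext_boundary T r" "\<sigma> \<in> adm0 (map lf_truncate \<rho>s)"
  obtains \<rho> where "\<rho> \<in> adm \<rho>s" "lf_truncate \<rho> = \<sigma>"
    "pairing_sum l \<rho>s \<rho> = pairing_sum (lf_length T r l) (map lf_truncate \<rho>s) \<sigma>"
proof -
  obtain \<rho> where \<rho>: "\<rho> \<in> ext_boundary T r" "\<rho> \<notin> set \<rho>s" "lf_truncate \<rho> = \<sigma>"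
    "\<And>\<tau>. \<tau> \<in> set \<rho>s \<Longrightarrow> path_arcs \<rho> \<inter> path_arcs \<tau> \<subseteq> arcs T0"
    using lift_admissible[OF assms] by blast
  then show ?thesis using that pairing_sum_truncate_eq[OF assms(1), of \<rho>] by auto
qed

text \<open>Every competitor in \<open>T0\<close> lifts to an admissible path of \<open>T\<close>
  with the same sum, so the minimum in \<open>T\<close> is a lower bound in \<open>T0\<close>.
  Applied to the truncation of \<rho>, whose sum is at most that minimum, this forces
  equality.\<close>

lemma arg_min_truncate:
  assumes l: "length_function T l" and \<rho>s: "set \<rho>s \<subseteq> ext_boundary T r"
    and \<rho>: "is_arg_min (pairing_sum l \<rho>s) (\<lambda>\<rho>. \<rho> \<in> adm \<rho>s) \<rho>"
  shows "is_arg_min (pairing_sum (lf_length T r l) (map lf_truncate \<rho>s))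
           (\<lambda>\<sigma>. \<sigma> \<in> adm0 (map lf_truncate \<rho>s)) (lf_truncate \<rho>)"
    and "pairing_sum (lf_length T r l) (map lf_truncate \<rho>s) (lf_truncate \<rho>) = pairing_sum l \<rho>s \<rho>"
proof -
  have a: "\<rho> \<in> ext_boundary T r" "\<rho> \<notin> set \<rho>s"
    and m: "\<And>\<tau>. \<tau> \<in> adm \<rho>s \<Longrightarrow> pairing_sum l \<rho>s \<rho> \<le> pairing_sum l \<rho>s \<tau>"
    using \<rho> by (auto simp: is_arg_min_linorder)
  have t: "lf_truncate \<rho> \<in> adm0 (map lf_truncate \<rho>s)" using truncate_admissible \<rho>s a by blast
  have min: "pairing_sum l \<rho>s \<rho> \<le> pairing_sum (lf_length T r l) (map lf_truncate \<rho>s) \<sigma>"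
    if "\<sigma> \<in> adm0 (map lf_truncate \<rho>s)" for \<sigma>
    using lift_pairing_sum[OF \<rho>s that] m by metis
  show eq: "pairing_sum (lf_length T r l) (map lf_truncate \<rho>s) (lf_truncate \<rho>) = pairing_sum l \<rho>s \<rho>"
    using pairing_sum_truncate_le[OF l \<rho>s a] min[OF t] by simp
  show "is_arg_min (pairing_sum (lf_length T r l) (map lf_truncate \<rho>s))
           (\<lambda>\<sigma>. \<sigma> \<in> adm0 (map lf_truncate \<rho>s)) (lf_truncate \<rho>)"
    using t min eq by (simp add: is_arg_min_linorder)
qed

text \<open>A lift of \<sigma> with the same sum is minimal, since any cheaper path of
  \<open>T\<close> would truncate to an admissible path cheaper than \<sigma>.\<close>

lemma arg_min_lift:
  assumes l: "length_function T l" and \<rho>s: "set \<rho>s \<subseteq> ext_boundary T r"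
    and \<sigma>: "is_arg_min (pairing_sum (lf_length T r l) (map lf_truncate \<rho>s))
           (\<lambda>\<sigma>. \<sigma> \<in> adm0 (map lf_truncate \<rho>s)) \<sigma>"
  obtains \<rho> where "is_arg_min (pairing_sum l \<rho>s) (\<lambda>\<rho>. \<rho> \<in> adm \<rho>s) \<rho>" "lf_truncate \<rho> = \<sigma>"
proof -
  have a: "\<sigma> \<in> adm0 (map lf_truncate \<rho>s)"
    and m: "\<And>\<tau>. \<tau> \<in> adm0 (map lf_truncate \<rho>s) \<Longrightarrow>
      pairing_sum (lf_length T r l) (map lf_truncate \<rho>s) \<sigma> \<le> pairing_sum (lf_length T r l) (map lf_truncate \<rho>s) \<tau>"
    using \<sigma> by (auto simp: is_arg_min_linorder)
  obtain \<rho> where \<rho>: "\<rho> \<in> adm \<rho>s" "lf_truncate \<rho> = \<sigma>"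
    "pairing_sum l \<rho>s \<rho> = pairing_sum (lf_length T r l) (map lf_truncate \<rho>s) \<sigma>"
    using lift_pairing_sum[OF \<rho>s a] by blast
  have "pairing_sum l \<rho>s \<rho> \<le> pairing_sum l \<rho>s \<tau>" if "\<tau> \<in> adm \<rho>s" for \<tau>
    using m[OF truncate_admissible[OF \<rho>s]] pairing_sum_truncate_le[OF l \<rho>s] that \<rho>(3)
    by (metis DiffD1 DiffD2 order_trans)
  then have "is_arg_min (pairing_sum l \<rho>s) (\<lambda>\<rho>. \<rho> \<in> adm \<rho>s) \<rho>"
    using \<rho>(1) by (simp add: is_arg_min_linorder)
  then show ?thesis using \<rho>(2) by (rule that)
qed

section \<open>Transfer of greedy runs and factorial values\<close>

lemma greedy_subset: "greedy adm l \<rho>s \<Longrightarrow> set \<rho>s \<subseteq> ext_boundary T r"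
  by (induction rule: greedy.induct) (auto simp: is_arg_min_def)

lemma greedy_truncate:
  assumes "length_function T l" "greedy adm l \<rho>s"
  shows "greedy adm0 (lf_length T r l) (map lf_truncate \<rho>s)"
  using assms(2)
proof (induction rule: greedy.induct)
  case (2 \<rho>s \<rho>)
  then show ?case using arg_min_truncate(1)[OF assms(1) greedy_subset]
    by (auto simp: greedy_snoc_iff)
qed (simp add: greedy.intros)

text \<open>Lifting goes along the whole run and not path by path, because each lift has to avoid
  the lifts already made.\<close>

lemma greedy_lift:
  assumes "length_function T l" "greedy adm0 (lf_length T r l) \<sigma>s"
  shows "\<exists>\<rho>s. greedy adm l \<rho>s \<and> map lf_truncate \<rho>s = \<sigma>s"
  using assms(2)
proof (induction rule: greedy.induct)
  case 1
  then show ?case by (auto intro: greedy.intros)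
next
  case (2 \<sigma>s \<sigma>)
  then obtain \<rho>s where \<rho>s: "greedy adm l \<rho>s" "map lf_truncate \<rho>s = \<sigma>s" by blast
  then obtain \<rho> where "is_arg_min (pairing_sum l \<rho>s) (\<lambda>\<rho>. \<rho> \<in> adm \<rho>s) \<rho>" "lf_truncate \<rho> = \<sigma>"
    using arg_min_lift[OF assms(1) greedy_subset[OF \<rho>s(1)]] 2(2) by blast
  then have "greedy adm l (\<rho>s @ [\<rho>]) \<and> map lf_truncate (\<rho>s @ [\<rho>]) = \<sigma>s @ [\<sigma>]"
    using \<rho>s by (simp add: greedy_snoc_iff)
  then show ?case by blast
qed

lemma factorial_value_lf:
  assumes l: "length_function T l"
  shows "factorial_value adm l n x \<longleftrightarrow> factorial_value adm0 (lf_length T r l) n x"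
proof -
  have eq: "pairing_sum (lf_length T r l) (map lf_truncate \<rho>s) (lf_truncate \<rho>) = pairing_sum l \<rho>s \<rho>"
    if "greedy adm l (\<rho>s @ [\<rho>])" for \<rho>s \<rho>
    using that arg_min_truncate(2)[OF l greedy_subset] by (auto simp: greedy_snoc_iff)
  show ?thesis
  proof
    assume "factorial_value adm l n x"
    then obtain \<rho>s \<rho> where "length \<rho>s = n" "greedy adm l (\<rho>s @ [\<rho>])" "x = pairing_sum l \<rho>s \<rho>"
      unfolding factorial_value_def by blast
    then show "factorial_value adm0 (lf_length T r l) n x"
      unfolding factorial_value_def using greedy_truncate[OF l] eq
      by (intro exI[of _ "map lf_truncate \<rho>s"] exI[of _ "lf_truncate \<rho>"]) fastforce
  next
    assume "factorial_value adm0 (lf_length T r l) n x"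
    then obtain \<sigma>s \<sigma> where \<sigma>: "length \<sigma>s = n" "greedy adm0 (lf_length T r l) (\<sigma>s @ [\<sigma>])"
      "x = pairing_sum (lf_length T r l) \<sigma>s \<sigma>"
      unfolding factorial_value_def by blast
    then obtain \<tau>s where \<tau>: "greedy adm l \<tau>s" "map lf_truncate \<tau>s = \<sigma>s @ [\<sigma>]"
      using greedy_lift[OF l] by blast
    then obtain \<rho>s \<rho> where "\<tau>s = \<rho>s @ [\<rho>]" "map lf_truncate \<rho>s = \<sigma>s" "lf_truncate \<rho> = \<sigma>"
      by (cases \<tau>s rule: rev_cases) auto
    then show "factorial_value adm l n x"
      unfolding factorial_value_def using \<tau> \<sigma> eq
      by (intro exI[of _ \<rho>s] exI[of _ \<rho>]) auto
  qed
qed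

end

theorem proposition1p5:
  fixes T :: "('v, 'e) pre_digraph" and r :: 'v and l :: "'e \<Rightarrow> real" and n :: nat
  assumes "rooted_tree T r"
    and "length_function T l"
  shows "tree_factorial T r l n =
         cap_tree_factorial (lf_component T r) r (lf_length T r l) (lf_capacity T) n"
proof -
  \<comment> \<open>Equality as predicates in the value settles both parts of
    \<open>factorial_seq\<close>: whether a term exists, and which number the definite description
    denotes.\<close>
  have "factorial_value (\<lambda>\<rho>s. ext_boundary T r - set \<rho>s) l n =
      factorial_value (cap_admissible (lf_component T r) r (lf_capacity T)) (lf_length T r l) n"
    by (rule ext) (rule rooted_tree.factorial_value_lf[OF assms])
  then show ?thesis by (simp add: tree_factorial_def cap_tree_factorial_def factorial_seq_def)
qed

end
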